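(* Let $n$ be even and let $\mathcal{S}_{\mathrm{int}}=\{[a,a+n/2]: a=1,\ldots,n/2\}\subseteq 2^{[n]}$. Suppose $\mathcal{A}$ is a (randomized) one-pass streaming algorithm that solves the $\alpha$-approximation subset-$\ell_p$ problem with respect to $\mathcal{S}_{\mathrm{int}}$ for some $\alpha\ge1$ and some $p\ge0$, in the turnstile model. Then for some turnstile stream input, $\mathcal{A}$ uses $\Omega(n)$ bits of space.
   Context: In the turnstile model the stream consists of pairs $(a_j,\Delta_j)\in[n]\times\{-1,1\}$, each adding $\Delta_j$ to coordinate $a_j$ of a vector $v\in\mathbb{R}^n$ initialized to zero. Subsets are identified with $0/1$ vectors; $u\circ v$ is the coordinatewise product; $\|v\|_0$ is the number of nonzero coordinates and $\|v\|_p=(\sum_i|v_i|^p)^{1/p}$ for $p>0$. The $\alpha$-approximation subset-$\ell_p$ problem w.r.t. $\mathcal{S}$: a one-pass algorithm over the stream (with $\mathcal{S}$ known in advance) outputs at the end a function $E:\mathcal{S}\to\mathbb{R}$ with $\Pr[\|v\circ s\|_p\le E(s)\le\alpha\|v\circ s\|_p]\ge0.9$ for every $s\in\mathcal{S}$. *)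

theory Defs
  imports "HOL-Probability.Probability"
begin

text \<open>Vectors of \<open>\<real>\<^sup>n\<close> are functions \<open>nat \<Rightarrow> real\<close> read on the coordinates \<open>{1..n}\<close>.\<close>

definition hadamard :: "(nat \<Rightarrow> real) \<Rightarrow> (nat \<Rightarrow> real) \<Rightarrow> nat \<Rightarrow> real" (infixl "\<circ>\<^sub>H" 70)
  where "u \<circ>\<^sub>H v = (\<lambda>i. u i * v i)"

definition lp_norm :: "nat \<Rightarrow> real \<Rightarrow> (nat \<Rightarrow> real) \<Rightarrow> real"
  where "lp_norm n p v =
    (if p = 0 then real (card {i \<in> {1..n}. v i \<noteq> 0})
     else (\<Sum>i = 1..n. \<bar>v i\<bar> powr p) powr (1 / p))"

type_synonym item = "nat \<times> int"

definition turnstile_streams :: "nat \<Rightarrow> item list set"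
  where "turnstile_streams n = lists ({1..n} \<times> {-1, 1})"

definition stream_vector :: "item list \<Rightarrow> nat \<Rightarrow> real"
  where "stream_vector \<sigma> = foldl (\<lambda>v (a, d). v(a := v a + of_int d)) (\<lambda>_. 0) \<sigma>"

text \<open>
  Randomness is an infinite tape of independent fair coin flips. The memory between two stream
  items is a bit string. Every transition sees the whole tape, the number of items read so
  far, the current memory and the next item. Reading the tape is free, and the position in the
  stream is available so that a transition may use coins not used before. Coins that are
  flipped on the fly and forgotten, and a random oracle, are thus both special cases. The
  algorithm may depend arbitrarily on \<open>n\<close>, \<open>p\<close>, \<open>\<alpha>\<close> and the set family.
\<close>

type_synonym tape = "nat \<Rightarrow> bool"

definition coin_tape :: "tape measure"
  where "coin_tape = PiM UNIV (\<lambda>_. measure_pmf (bernoulli_pmf (1 / 2)))"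

record streaming_alg =
  alg_init :: "tape \<Rightarrow> bool list"
  alg_step :: "tape \<Rightarrow> nat \<Rightarrow> bool list \<Rightarrow> item \<Rightarrow> bool list"
  alg_out :: "tape \<Rightarrow> nat \<Rightarrow> bool list \<Rightarrow> nat set \<Rightarrow> real"

definition memory_after :: "streaming_alg \<Rightarrow> tape \<Rightarrow> item list \<Rightarrow> bool list"
  where "memory_after A \<omega> \<sigma> =
    foldl (\<lambda>m (t, x). alg_step A \<omega> t m x) (alg_init A \<omega>) (List.enumerate 0 \<sigma>)"

definition final_output :: "streaming_alg \<Rightarrow> tape \<Rightarrow> item list \<Rightarrow> nat set \<Rightarrow> real"
  where "final_output A \<omega> \<sigma> = alg_out A \<omega> (length \<sigma>) (memory_after A \<omega> \<sigma>)"

text \<open>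
  Worst-case number of bits of memory while processing \<open>\<sigma>\<close>, over all coin outcomes up to
  probability zero.
\<close>

definition space_used :: "streaming_alg \<Rightarrow> item list \<Rightarrow> enat"
  where "space_used A \<sigma> =
    Inf {b. AE \<omega> in coin_tape.
              \<forall>t \<le> length \<sigma>. enat (length (memory_after A \<omega> (take t \<sigma>))) \<le> b}"

text \<open>
  The measure of a non-measurable set is \<open>0\<close>, so the bound below also forces the success
  events to be measurable.
\<close>

definition solves_subset_lp ::
    "nat \<Rightarrow> real \<Rightarrow> real \<Rightarrow> nat set set \<Rightarrow> streaming_alg \<Rightarrow> bool"
  where "solves_subset_lp n \<alpha> p S A \<longleftrightarrow>
    (\<forall>\<sigma> \<in> turnstile_streams n. \<forall>s \<in> S.
       \<P>(\<omega> in coin_tape.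
          lp_norm n p (stream_vector \<sigma> \<circ>\<^sub>H indicator s) \<le> final_output A \<omega> \<sigma> s \<and>
          final_output A \<omega> \<sigma> s \<le> \<alpha> * lp_norm n p (stream_vector \<sigma> \<circ>\<^sub>H indicator s))
       \<ge> 9 / 10)"

definition S_int :: "nat \<Rightarrow> nat set set"
  where "S_int n = {{a..a + n div 2} | a. a \<in> {1..n div 2}}"

end

theory Submission
  imports Defs
begin

text \<open>
  The lower bound is by reduction from augmented indexing. Put \<open>m = n / 2\<close> and encode a bit
  string of length \<open>m\<close> as signs on the coordinates \<open>1, \<dots>, m\<close>. The interval
  \<open>[a, a + m]\<close> meets these coordinates in \<open>{a..m}\<close>. A continuation of the stream that cancels
  the coordinates beyond \<open>a\<close> and adds \<open>1\<close> at \<open>a\<close> thus makes the norm on the interval vanish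
  exactly if the \<open>a\<close>-th sign is \<open>-1\<close>, so that any multiplicative approximation reveals this
  sign to whoever knows the later ones.

  Fix coins for which at most a fraction \<open>1/8\<close> of all answers is wrong. Then every memory state
  is a predictor which guesses each bit from the later ones, and for a fixed predictor the sum of
  \<open>t\<close> to the number of wrong guesses over all strings of length \<open>m\<close> is exactly \<open>(1 + t) ^ m\<close>.
  With \<open>t = 1/4\<close>, convexity bounds the number of states from below exponentially in \<open>m\<close>.
\<close>

section \<open>Predicting the bits of a string from the later ones\<close>

fun prediction_errors :: "(bool list \<Rightarrow> bool) \<Rightarrow> bool list \<Rightarrow> nat" where
  "prediction_errors g [] = 0"
| "prediction_errors g (x # xs) = of_bool (g xs \<noteq> x) + prediction_errors g xs"

lemma prediction_errors_eq_sum: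
  "prediction_errors g xs = (\<Sum>i<length xs. of_bool (g (drop (Suc i) xs) \<noteq> xs ! i))"
  by (induction xs) (simp_all add: sum.lessThan_Suc_shift del: sum.lessThan_Suc)

lemma lists_length_Suc_eq:
  "{xs :: bool list. length xs = Suc m} =
     (#) True ` {xs. length xs = m} \<union> (#) False ` {xs. length xs = m}"
  by (auto simp: length_Suc_conv image_iff)

lemma finite_bool_lists_length: "finite {xs :: bool list. length xs = m}"
  using finite_lists_length_eq[of "UNIV :: bool set" m] by simp

lemma card_bool_lists_length: "card {xs :: bool list. length xs = m} = 2 ^ m"
  using card_lists_length_eq[of "UNIV :: bool set" m] by simp

lemma finite_bool_lists_length_le: "finite {xs :: bool list. length xs \<le> m}"
  using finite_lists_length_le[of "UNIV :: bool set" m] by simp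

text \<open>For a fixed tail exactly one of the two possible heads contradicts the guess
  \<open>g xs\<close>. Prepending a bit thus contributes a factor \<open>1 + t\<close>, whatever
  \<open>g\<close> is.\<close>

lemma sum_power_prediction_errors:
  fixes t :: real
  shows "(\<Sum>xs | length xs = m. t ^ prediction_errors g xs) = (1 + t) ^ m"
proof (induction m)
  case 0
  then show ?case by simp
next
  case (Suc m)
  let ?L = "{xs :: bool list. length xs = m}"
  have "(\<Sum>xs | length xs = Suc m. t ^ prediction_errors g xs) =
      (\<Sum>xs\<in>?L. t ^ prediction_errors g (True # xs)) + (\<Sum>xs\<in>?L. t ^ prediction_errors g (False # xs))"
    unfolding lists_length_Suc_eq
    by (subst sum.union_disjoint)
      (auto simp: finite_bool_lists_length sum.reindex inj_on_def simp del: prediction_errors.simps)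
  also have "\<dots> = (\<Sum>xs\<in>?L. (1 + t) * t ^ prediction_errors g xs)"
    unfolding sum.distrib[symmetric] by (rule sum.cong) (auto simp: algebra_simps)
  also have "\<dots> = (1 + t) ^ Suc m"
    using Suc by (simp add: sum_distrib_left[symmetric])
  finally show ?case .
qed

text \<open>Base \<open>4\<close> instead of \<open>2\<close> absorbs the shorter lengths and leaves
  no constant factor, which keeps the later contradiction valid for small \<open>m\<close>.\<close>

lemma card_bool_lists_length_le: "card {xs :: bool list. length xs \<le> b} \<le> 4 ^ b"
proof (induction b)
  case 0
  then show ?case by simp
next
  case (Suc b)
  have "{xs :: bool list. length xs \<le> Suc b} =
      {xs. length xs \<le> b} \<union> {xs. length xs = Suc b}" by auto
  then have "card {xs :: bool list. length xs \<le> Suc b} \<le> 4 ^ b + 2 ^ Suc b"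
    using Suc card_Un_le[of "{xs :: bool list. length xs \<le> b}" "{xs. length xs = Suc b}"]
    by (simp only: card_bool_lists_length)
  also have "(2::nat) ^ b \<le> 4 ^ b" by (rule power_mono) auto
  then have "(4::nat) ^ b + 2 ^ Suc b \<le> 4 ^ Suc b" by simp
  finally show ?case .
qed

text \<open>Jensen's inequality for the exponential with base \<open>c\<close>, by its tangent line
  at \<open>k\<close>. Its slope has the sign of \<open>ln c\<close>, so an upper bound on the mean
  of \<open>f\<close> is the right hypothesis.\<close>

lemma sum_powr_ge_card_mult_powr_avg:
  fixes f :: "'a \<Rightarrow> real"
  assumes "finite A" "0 < c" "c \<le> 1" "(\<Sum>x\<in>A. f x) \<le> real (card A) * k"
  shows "real (card A) * c powr k \<le> (\<Sum>x\<in>A. c powr f x)"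
proof -
  have "ln c \<le> 0" using assms by simp
  then have "0 \<le> ln c * (\<Sum>x\<in>A. f x - k)"
    using assms by (intro mult_nonpos_nonpos) (auto simp: sum_subtractf)
  then have "c powr k * real (card A) \<le> c powr k * (real (card A) + ln c * (\<Sum>x\<in>A. f x - k))"
    by (intro mult_left_mono) auto
  then have "real (card A) * c powr k \<le> c powr k * (real (card A) + ln c * (\<Sum>x\<in>A. f x - k))"
    by (simp only: mult.commute)
  also have "\<dots> = (\<Sum>x\<in>A. c powr k * (1 + ln c * (f x - k)))"
    by (simp add: sum_distrib_left[symmetric] sum.distrib)
  also have "\<dots> \<le> (\<Sum>x\<in>A. c powr f x)"
  proof (rule sum_mono)
    fix x
    have "c powr k * (1 + ln c * (f x - k)) \<le> c powr k * exp (ln c * (f x - k))"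
      by (intro mult_left_mono exp_ge_add_one_self) auto
    also have "\<dots> = c powr f x"
      using assms by (simp add: powr_def exp_add[symmetric] algebra_simps)
    finally show "c powr k * (1 + ln c * (f x - k)) \<le> c powr f x" .
  qed
  finally show ?thesis .
qed

text \<open>Few errors on average make the sum of \<open>1/4\<close> to the number of errors large.
  Summing over all states of length at most \<open>b\<close>, not just the one that \<open>M\<close>
  assigns, only increases it, and each state then contributes \<open>(5/4) ^ m\<close>.\<close>

lemma few_prediction_errors_imp_many_states:
  fixes M :: "bool list \<Rightarrow> bool list" and g :: "bool list \<Rightarrow> bool list \<Rightarrow> bool"
  assumes "m > 0" and len: "\<And>xs. length xs = m \<Longrightarrow> length (M xs) \<le> b"
    and err: "(\<Sum>xs | length xs = m. real (prediction_errors (g (M xs)) xs)) \<le> 2 ^ m * (real m / 8)"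
  shows "real m / 8 < real b"
proof (rule ccontr)
  assume "\<not> real m / 8 < real b"
  then have b: "real b \<le> real m / 8" by simp
  let ?L = "{xs :: bool list. length xs = m}" and ?N = "{xs :: bool list. length xs \<le> b}"
  let ?e = "\<lambda>s xs. prediction_errors (g s) xs"
  have "2 ^ m * (1/4) powr (real m / 8) \<le> (\<Sum>xs\<in>?L. (1/4) powr real (?e (M xs) xs))"
    using sum_powr_ge_card_mult_powr_avg[of ?L "1/4" "\<lambda>xs. real (?e (M xs) xs)" "real m / 8"] err
    by (simp add: finite_bool_lists_length card_bool_lists_length)
  also have "\<dots> \<le> (\<Sum>xs\<in>?L. \<Sum>s\<in>?N. (1/4) ^ ?e s xs)"
  proof (rule sum_mono)
    fix xs assume "xs \<in> ?L"
    then show "(1/4) powr real (?e (M xs) xs) \<le> (\<Sum>s\<in>?N. (1/4) ^ ?e s xs)"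
      using len member_le_sum[of "M xs" ?N "\<lambda>s. (1/4::real) ^ ?e s xs"]
      by (simp add: powr_realpow finite_bool_lists_length_le)
  qed
  also have "\<dots> = real (card ?N) * (5/4) ^ m"
    by (subst sum.swap) (simp add: sum_power_prediction_errors)
  also have "\<dots> \<le> 4 powr (real m / 8) * (5/4) ^ m"
  proof (rule mult_right_mono)
    have "real (card ?N) \<le> 4 ^ b"
      using card_bool_lists_length_le[of b] by (metis of_nat_le_iff of_nat_numeral of_nat_power)
    also have "\<dots> = 4 powr real b" by (simp add: powr_realpow)
    also have "\<dots> \<le> 4 powr (real m / 8)" using b by (intro powr_mono) auto
    finally show "real (card ?N) \<le> 4 powr (real m / 8)" .
  qed simp
  finally have "2 ^ m * ((1/4) powr (real m / 8) * 4 powr (real m / 8))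
      \<le> 4 powr (real m / 8) * (5/4) ^ m * 4 powr (real m / 8)"
    by (simp add: mult.assoc[symmetric] mult_right_mono)
  moreover have "(1/4::real) powr (real m / 8) * 4 powr (real m / 8) = 1"
    by (simp add: powr_mult[symmetric])
  \<comment> \<open>One factor comes from the error rate, the other from the number of
    states.\<close>
  moreover have "(4::real) powr (real m / 8) * 4 powr (real m / 8) = sqrt 2 ^ m"
  proof -
    have "(4::real) = 2 powr 2" by simp
    then have "(4::real) powr (real m / 8) * 4 powr (real m / 8) = 2 powr (real m / 2)"
      by (simp only: powr_powr powr_add[symmetric]) simp
    also have "\<dots> = (2 powr (1/2)) powr real m" by (simp add: powr_powr)
    also have "\<dots> = sqrt 2 ^ m" by (simp add: powr_half_sqrt powr_realpow)
    finally show ?thesis .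
  qed
  ultimately have "2 ^ m \<le> (sqrt 2 * (5/4)) ^ m"
    by (simp add: power_mult_distrib mult_ac del: times_divide_eq_left times_divide_eq_right)
  \<comment> \<open>\<open>8/5\<close> is the break-even value, since
    \<open>8/5 * (5/4) = 2\<close>, and its square exceeds \<open>2\<close>.\<close>
  moreover have "sqrt 2 * (5/4) < (2::real)"
    using real_less_lsqrt[of "8/5" 2] by (simp add: power2_eq_square)
  then have "(sqrt 2 * (5/4)) ^ m < (2::real) ^ m"
    using \<open>m > 0\<close> by (intro power_strict_mono) auto
  ultimately show False by simp
qed

section \<open>Streams and their vectors\<close>

lemma stream_vector_eq_sum_list:
  "stream_vector \<sigma> i = (\<Sum>(a, d)\<leftarrow>\<sigma>. if a = i then of_int d else 0)"
proof -
  have "foldl (\<lambda>v (a, d). v(a := v a + of_int d)) v \<sigma> i =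
      v i + (\<Sum>(a, d)\<leftarrow>\<sigma>. if a = i then of_int d else (0::real))" for v
    by (induction \<sigma> arbitrary: v) auto
  then show ?thesis by (simp add: stream_vector_def)
qed

lemma stream_vector_append:
  "stream_vector (\<sigma> @ \<tau>) i = stream_vector \<sigma> i + stream_vector \<tau> i"
  by (simp add: stream_vector_eq_sum_list)

lemma stream_vector_Cons:
  "stream_vector ((a, d) # \<tau>) i = (if a = i then of_int d else 0) + stream_vector \<tau> i"
  by (simp add: stream_vector_eq_sum_list)

definition coord_stream :: "(bool \<Rightarrow> int) \<Rightarrow> nat \<Rightarrow> bool list \<Rightarrow> item list" where
  "coord_stream f k xs = map (\<lambda>(i, x). (i, f x)) (List.enumerate k xs)"

lemma length_coord_stream [simp]: "length (coord_stream f k xs) = length xs"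
  by (simp add: coord_stream_def)

lemma coord_stream_Cons: "coord_stream f k (x # xs) = (k, f x) # coord_stream f (Suc k) xs"
  by (simp add: coord_stream_def)

lemma stream_vector_coord_stream:
  "stream_vector (coord_stream f k xs) i =
     (if k \<le> i \<and> i < k + length xs then of_int (f (xs ! (i - k))) else 0)"
proof (induction xs arbitrary: k)
  case Nil
  then show ?case by (simp add: coord_stream_def stream_vector_def)
next
  case (Cons x xs)
  then show ?case
    by (auto simp: coord_stream_Cons stream_vector_Cons nth_Cons' Suc_diff_Suc not_less_eq_eq)
qed

lemma coord_stream_in_turnstile_streams:
  assumes "\<And>x. f x \<in> {-1, 1}" "1 \<le> k" "k + length xs \<le> Suc n"
  shows "coord_stream f k xs \<in> turnstile_streams n"
  using assms(2,3)
proof (induction xs arbitrary: k)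
  case Nil
  then show ?case by (simp add: coord_stream_def turnstile_streams_def)
next
  case (Cons x xs)
  then show ?case
    using Cons.IH[of "Suc k"] assms(1)[of x]
    by (simp add: coord_stream_Cons turnstile_streams_def)
qed

section \<open>The two streams of the reduction\<close>

definition bit_sign :: "bool \<Rightarrow> int" where
  "bit_sign x = (if x then 1 else -1)"

definition encoding_stream :: "bool list \<Rightarrow> item list" where
  "encoding_stream xs = coord_stream bit_sign 1 xs"

text \<open>Bits of a list are numbered from \<open>0\<close>, coordinates from \<open>1\<close>.\<close>

definition query_stream :: "nat \<Rightarrow> bool list \<Rightarrow> item list" where
  "query_stream i ys = (Suc i, 1) # coord_stream (\<lambda>x. - bit_sign x) (Suc (Suc i)) ys"

lemma encoding_stream_in_turnstile_streams:
  "length xs \<le> n \<Longrightarrow> encoding_stream xs \<in> turnstile_streams n"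
  unfolding encoding_stream_def
  by (rule coord_stream_in_turnstile_streams) (auto simp: bit_sign_def)

lemma query_stream_in_turnstile_streams:
  assumes "Suc i + length ys \<le> n"
  shows "query_stream i ys \<in> turnstile_streams n"
proof -
  have "coord_stream (\<lambda>x. - bit_sign x) (Suc (Suc i)) ys \<in> turnstile_streams n"
    using assms by (intro coord_stream_in_turnstile_streams) (auto simp: bit_sign_def)
  then show ?thesis using assms by (simp add: query_stream_def turnstile_streams_def)
qed

text \<open>At \<open>Suc i\<close> the sign meets an added \<open>1\<close>; every later sign meets
  its negative. Coordinates before \<open>Suc i\<close> keep their signs, hence the restriction on
  \<open>j\<close>.\<close>

lemma stream_vector_encoding_query:
  assumes "i < length xs" "Suc i \<le> j"
  shows "stream_vector (encoding_stream xs @ query_stream i (drop (Suc i) xs)) j =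
    (if j = Suc i \<and> xs ! i then 2 else 0)"
proof (cases "j = Suc i")
  case True
  then show ?thesis
    using assms by (simp add: stream_vector_append encoding_stream_def query_stream_def
        stream_vector_Cons stream_vector_coord_stream bit_sign_def)
next
  case False
  then obtain k where "j = Suc (Suc i) + k"
    using assms(2) by (metis Suc_leI le_Suc_ex le_neq_implies_less)
  then show ?thesis
    using assms(1) by (auto simp: stream_vector_append encoding_stream_def query_stream_def
        stream_vector_Cons stream_vector_coord_stream)
qed

section \<open>Reading a bit off the norm\<close>

lemma lp_norm_eq_0: "(\<And>i. i \<in> {1..n} \<Longrightarrow> v i = 0) \<Longrightarrow> lp_norm n p v = 0"
  by (auto simp: lp_norm_def)

lemma lp_norm_pos:
  assumes "i \<in> {1..n}" "v i \<noteq> 0"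
  shows "lp_norm n p v > 0"
proof -
  have "card {i \<in> {1..n}. v i \<noteq> 0} > 0"
    using assms by (subst card_gt_0_iff) auto
  moreover have "(\<Sum>i = 1..n. \<bar>v i\<bar> powr p) > 0"
    using assms by (intro sum_pos2[of _ i]) auto
  ultimately show ?thesis by (auto simp: lp_norm_def)
qed

text \<open>The interval hides the uncancelled coordinates below \<open>Suc i\<close>. If
  \<open>N = 0\<close>, the two bounds force \<open>e = 0\<close>; if \<open>N > 0\<close>, the
  lower bound makes \<open>e\<close> positive.\<close>

lemma approximation_reveals_bit:
  fixes n i :: nat and xs :: "bool list" and p :: real
  defines "N \<equiv> lp_norm n p (stream_vector (encoding_stream xs @ query_stream i (drop (Suc i) xs))
                  \<circ>\<^sub>H indicator {Suc i..Suc i + n div 2})"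
  assumes "i < length xs" "length xs \<le> n" "N \<le> e" "e \<le> \<alpha> * N"
  shows "e > 0 \<longleftrightarrow> xs ! i"
proof (cases "xs ! i")
  case True
  have "N > 0"
    unfolding N_def using assms(2,3) True
    by (intro lp_norm_pos[of "Suc i"]) (auto simp: hadamard_def stream_vector_encoding_query)
  then show ?thesis using assms True by simp
next
  case False
  have "N = 0"
    unfolding N_def using assms(2) False
    by (intro lp_norm_eq_0)
      (auto simp: hadamard_def stream_vector_encoding_query indicator_def)
  then show ?thesis using assms(4,5) False by simp
qed

section \<open>Streaming algorithms\<close>

interpretation coin_tape: prob_space coin_tape
  unfolding coin_tape_def by (intro prob_space_PiM measure_pmf.prob_space_axioms)

text \<open>Since \<open>enat\<close> is well ordered, the infimum in \<open>space_used\<close> is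
  attained; the final memory is the case \<open>t = length \<sigma>\<close>.\<close>

lemma AE_length_memory_le_space_used:
  "AE \<omega> in coin_tape. enat (length (memory_after A \<omega> \<sigma>)) \<le> space_used A \<sigma>"
proof -
  let ?T = "{b. AE \<omega> in coin_tape.
              \<forall>t \<le> length \<sigma>. enat (length (memory_after A \<omega> (take t \<sigma>))) \<le> b}"
  have "\<infinity> \<in> ?T" by simp
  then have "(LEAST b. b \<in> ?T) \<in> ?T" and "?T \<noteq> {}" by (rule LeastI, blast)
  then have "space_used A \<sigma> \<in> ?T"
    unfolding space_used_def Inf_enat_def by (simp only: if_False)
  then have "AE \<omega> in coin_tape.
      \<forall>t \<le> length \<sigma>. enat (length (memory_after A \<omega> (take t \<sigma>))) \<le> space_used A \<sigma>" by simp
  then show ?thesis by eventually_elim (metis order_refl take_all)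
qed

text \<open>The memory enters as the argument \<open>s\<close>, so that a memory state yields a predictor.\<close>

definition decode ::
    "streaming_alg \<Rightarrow> tape \<Rightarrow> nat \<Rightarrow> nat \<Rightarrow> bool list \<Rightarrow> bool list \<Rightarrow> bool" where
  "decode A \<omega> n m s ys =
     (let i = m - Suc (length ys); \<tau> = query_stream i ys in
      alg_out A \<omega> (m + length \<tau>)
        (foldl (\<lambda>s (t, x). alg_step A \<omega> t s x) s (List.enumerate m \<tau>))
        {Suc i..Suc i + n div 2} > 0)"

text \<open>The run on the concatenation resumes from the memory after the encoding, at time
  \<open>length xs\<close>. The length of the tail determines \<open>i\<close>.\<close>

lemma decode_memory_after:
  assumes "i < length xs"
  shows "decode A \<omega> n (length xs) (memory_after A \<omega> (encoding_stream xs)) (drop (Suc i) xs) \<longleftrightarrow>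
    final_output A \<omega> (encoding_stream xs @ query_stream i (drop (Suc i) xs))
      {Suc i..Suc i + n div 2} > 0"
proof -
  have "length xs - Suc (length (drop (Suc i) xs)) = i" using assms by simp
  then show ?thesis
    by (simp add: decode_def final_output_def memory_after_def enumerate_append_eq Let_def
        encoding_stream_def)
qed

text \<open>First moment method: the expected sum is below \<open>K\<close>, so the sum is below
  \<open>K\<close> with positive probability, and this event cannot lie inside the null set where
  \<open>P\<close> fails.\<close>

lemma (in prob_space) ex_sum_indicator_lt:
  assumes "finite I" and "\<And>i. i \<in> I \<Longrightarrow> E i \<in> events" "\<And>i. i \<in> I \<Longrightarrow> prob (E i) \<le> q"
    and "real (card I) * q < K" and "AE \<omega> in M. P \<omega>"
  obtains \<omega> where "\<omega> \<in> space M" "P \<omega>" "(\<Sum>i\<in>I. indicator (E i) \<omega>) < K"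
proof -
  have int: "integrable M (\<lambda>\<omega>. \<Sum>i\<in>I. indicat_real (E i) \<omega>)"
    using assms(2) by (intro Bochner_Integration.integrable_sum) (auto simp: integrable_indicator_iff emeasure_eq_measure)
  have "expectation (\<lambda>\<omega>. \<Sum>i\<in>I. indicat_real (E i) \<omega>) = (\<Sum>i\<in>I. prob (E i))"
    using assms(2) by (subst Bochner_Integration.integral_sum)
      (auto simp: integrable_indicator_iff emeasure_eq_measure intro!: sum.cong)
  also have "\<dots> \<le> real (card I) * q" using sum_bounded_above[of I "\<lambda>i. prob (E i)" q] assms(3) by auto
  finally have "expectation (\<lambda>\<omega>. \<Sum>i\<in>I. indicat_real (E i) \<omega>) < K" using assms(4) by simp
  then have "\<not> (AE \<omega> in M. K \<le> (\<Sum>i\<in>I. indicat_real (E i) \<omega>))"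
    using integral_ge_const[OF int, of K] by auto
  then have "\<not> (\<forall>\<omega>\<in>space M. P \<omega> \<longrightarrow> K \<le> (\<Sum>i\<in>I. indicat_real (E i) \<omega>))"
    using assms(5) by (metis (mono_tags, lifting) AE_mp AE_I2)
  then show ?thesis using that by (meson not_le)
qed

section \<open>Assembling the reduction\<close>

lemma space_lower_bound:
  assumes "even n" "n > 0" and solves: "solves_subset_lp n \<alpha> p (S_int n) A"
  shows "\<exists>\<sigma>\<in>turnstile_streams n. ereal (1/16 * real n) \<le> ereal_of_enat (space_used A \<sigma>)"
proof (rule ccontr)
  assume neg: "\<not> ?thesis"
  define m where "m = n div 2"
  have m: "m > 0" "n = 2 * m" using assms by (auto simp: m_def)
  \<comment> \<open>Fewer than \<open>n / 16 = m / 8\<close> bits means at most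
    \<open>m div 8\<close>, as lengths are integers.\<close>
  define b where "b = m div 8"
  let ?L = "{xs :: bool list. length xs = m}"
  define \<sigma> where "\<sigma> = (\<lambda>(xs, i). encoding_stream xs @ query_stream i (drop (Suc i) xs))"
  define s where "s = (\<lambda>i. {Suc i..Suc i + n div 2})"
  define N where "N = (\<lambda>(xs, i). lp_norm n p (stream_vector (\<sigma> (xs, i)) \<circ>\<^sub>H indicator (s i)))"
  define good where "good = (\<lambda>(xs, i). {\<omega> \<in> space coin_tape.
    N (xs, i) \<le> final_output A \<omega> (\<sigma> (xs, i)) (s i) \<and>
    final_output A \<omega> (\<sigma> (xs, i)) (s i) \<le> \<alpha> * N (xs, i)})"
  let ?bad = "\<lambda>z. space coin_tape - good z"

  have good: "measure coin_tape (good (xs, i)) \<ge> 9/10" if "xs \<in> ?L" "i < m" for xs i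
  proof -
    have "\<sigma> (xs, i) \<in> turnstile_streams n"
      using that m encoding_stream_in_turnstile_streams[of xs n]
        query_stream_in_turnstile_streams[of i "drop (Suc i) xs" n]
      by (auto simp: \<sigma>_def turnstile_streams_def)
    moreover have "s i \<in> S_int n"
      using that by (auto simp: s_def S_int_def m_def intro!: exI[of _ "Suc i"])
    ultimately show ?thesis
      using solves by (auto simp: solves_subset_lp_def good_def N_def)
  qed
  \<comment> \<open>A set of nonzero \<open>measure\<close> is measurable.\<close>
  have good_sets: "good z \<in> sets coin_tape" if "z \<in> ?L \<times> {..<m}" for z
    using that good measure_notin_sets[of "good z" coin_tape] by fastforce

  have length_le: "AE \<omega> in coin_tape. length (memory_after A \<omega> (encoding_stream xs)) \<le> b"
    if "xs \<in> ?L" for xs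
  proof -
    have "ereal_of_enat (space_used A (encoding_stream xs)) < ereal (1/16 * real n)"
      using neg encoding_stream_in_turnstile_streams[of xs n] that m by (auto simp: not_le)
    then obtain k where k: "space_used A (encoding_stream xs) = enat k" "real k < 1/16 * real n"
      by (cases "space_used A (encoding_stream xs)") auto
    then have "k \<le> b" using m by (simp add: b_def)
    show ?thesis
      using AE_length_memory_le_space_used[of A "encoding_stream xs"]
      by eventually_elim (use k \<open>k \<le> b\<close> in auto)
  qed
  \<comment> \<open>There are finitely many strings, so one null set of coins serves them
    all.\<close>
  have "AE \<omega> in coin_tape. \<forall>xs\<in>?L. length (memory_after A \<omega> (encoding_stream xs)) \<le> b"
    using length_le by (intro AE_finite_allI finite_bool_lists_length)
  moreover have "measure coin_tape (?bad z) \<le> 1/10" if "z \<in> ?L \<times> {..<m}" for z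
    using that good good_sets by (auto simp: coin_tape.prob_compl)
  \<comment> \<open>The failure rate \<open>1/10\<close> lies strictly below the tolerated error
    rate \<open>1/8\<close>.\<close>
  moreover have "real (card (?L \<times> {..<m})) * (1/10) < 2 ^ m * (real m / 8)"
    using m by (simp add: card_cartesian_product card_bool_lists_length)
  ultimately obtain \<omega> where \<omega>: "\<omega> \<in> space coin_tape"
      "\<forall>xs\<in>?L. length (memory_after A \<omega> (encoding_stream xs)) \<le> b"
      "(\<Sum>z\<in>?L \<times> {..<m}. indicat_real (?bad z) \<omega>) < 2 ^ m * (real m / 8)"
    using coin_tape.ex_sum_indicator_lt[of "?L \<times> {..<m}" ?bad "1/10"] good_sets
      finite_bool_lists_length[of m]
    by (smt (verit, best) finite_SigmaI finite_lessThan sets.compl_sets)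

  let ?M = "\<lambda>xs. memory_after A \<omega> (encoding_stream xs)"
  have "(\<Sum>xs\<in>?L. real (prediction_errors (decode A \<omega> n m (?M xs)) xs)) \<le>
      (\<Sum>xs\<in>?L. \<Sum>i<m. indicat_real (?bad (xs, i)) \<omega>)"
  proof (rule sum_mono)
    fix xs assume xs: "xs \<in> ?L"
    \<comment> \<open>A wrong guess at bit \<open>i\<close> requires that the algorithm fails on the
      corresponding stream and interval.\<close>
    have "of_bool (decode A \<omega> n m (?M xs) (drop (Suc i) xs) \<noteq> xs ! i) \<le>
        indicat_real (?bad (xs, i)) \<omega>" if i: "i < m" for i
    proof (cases "\<omega> \<in> good (xs, i)")
      case True
      then have "final_output A \<omega> (\<sigma> (xs, i)) (s i) > 0 \<longleftrightarrow> xs ! i"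
        using approximation_reveals_bit[of i xs n p _ \<alpha>] xs i m
        by (auto simp: good_def N_def \<sigma>_def s_def)
      then show ?thesis
        using decode_memory_after[of i xs A \<omega> n] xs i by (auto simp: \<sigma>_def s_def)
    next
      case False
      then show ?thesis using \<omega>(1) by simp
    qed
    then show "real (prediction_errors (decode A \<omega> n m (?M xs)) xs) \<le>
        (\<Sum>i<m. indicat_real (?bad (xs, i)) \<omega>)"
      using xs by (auto simp: prediction_errors_eq_sum of_nat_sum intro!: sum_mono
          simp del: sum_of_bool_eq)
  qed
  also have "\<dots> \<le> 2 ^ m * (real m / 8)"
    using \<omega>(3) by (simp add: sum.cartesian_product)
  finally have "real m / 8 < real b"
    using few_prediction_errors_imp_many_states[of m ?M b "decode A \<omega> n m"] m \<omega>(2) by auto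
  then show False by (simp add: b_def)
qed

theorem mainTheorem3:
  "\<exists>c > 0. \<forall>(n::nat) (\<alpha>::real) (p::real) (A::streaming_alg).
     even n \<longrightarrow> \<alpha> \<ge> 1 \<longrightarrow> p \<ge> 0 \<longrightarrow> solves_subset_lp n \<alpha> p (S_int n) A \<longrightarrow>
     (\<exists>\<sigma> \<in> turnstile_streams n. ereal (c * real n) \<le> ereal_of_enat (space_used A \<sigma>))"
proof (intro exI[of _ "1/16"] conjI allI impI)
  fix n :: nat and \<alpha> p :: real and A :: streaming_alg
  assume "even n" and solves: "solves_subset_lp n \<alpha> p (S_int n) A"
  show "\<exists>\<sigma> \<in> turnstile_streams n. ereal (1/16 * real n) \<le> ereal_of_enat (space_used A \<sigma>)"
  proof (cases "n = 0")
    case True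
    \<comment> \<open>For \<open>n = 0\<close> the required bound is \<open>0\<close>.\<close>
    then show ?thesis by (intro bexI[of _ "[]"]) (auto simp: turnstile_streams_def zero_ereal_def[symmetric])
  next
    case False
    then show ?thesis using space_lower_bound \<open>even n\<close> solves by simp
  qed
qed simp

end
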